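(* Let $A,B$ be positive invertible operators on a Hilbert space such that $mA\le B\le MA$ with $1\le m\le M$, and let $s,t>0$. Then: (i) If $t\ge s$, then $$0\le e^{\eta(m,s)(t-s)}\,T_s(A|B)\le T_t(A|B)\le e^{\eta(M,t)(t-s)}\,T_s(A|B).$$ (ii) If $s\ge t$, then $$0\le e^{\eta(M,s)(t-s)}\,T_s(A|B)\le T_t(A|B)\le e^{\eta(m,t)(t-s)}\,T_s(A|B).$$ Here $\eta(x,a):=\dfrac{x^a\log x-\ln_a x}{a\ln_a x}$ for $a>0$ and $x>0$, with $\eta(1,a):=\lim_{x\to1}\eta(x,a)=0$.
   Context: For $x>0$ and $t\ne0$, $\ln_t x:=\frac{x^t-1}{t}$. For positive invertible operators $A,B$, the Tsallis relative operator entropy is $T_t(A|B):=A^{1/2}\ln_t(A^{-1/2}BA^{-1/2})A^{1/2}$ (functional calculus). For self-adjoint operators, $X\le Y$ means $Y-X$ is positive semidefinite. *)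

theory Defs
  imports "HOL-Analysis.Analysis" "HOL-Computational_Algebra.Polynomial"
    "HOL-Real_Asymp.Real_Asymp"
begin

section \<open>Complex Hilbert spaces\<close>

text \<open>
  The real inner product, norm and metric of the library are those induced by the complex inner
  product: \<open>x \<bullet> y = Re \<langle>x, y\<rangle>\<close>, hence \<open>norm x = sqrt (Re \<langle>x, x\<rangle>)\<close>, and definiteness is
  inherited from \<^class>\<open>real_inner\<close>. The complex inner product is linear in its first argument.
\<close>

class complex_hilbert = real_inner + complete_space +
  fixes scaleC :: "complex \<Rightarrow> 'a \<Rightarrow> 'a"  (infixr "*\<^sub>C" 75)
    and cinner :: "'a \<Rightarrow> 'a \<Rightarrow> complex"
  assumes scaleC_add_right: "c *\<^sub>C (x + y) = c *\<^sub>C x + c *\<^sub>C y"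
    and scaleC_add_left: "(c + d) *\<^sub>C x = c *\<^sub>C x + d *\<^sub>C x"
    and scaleC_scaleC: "c *\<^sub>C (d *\<^sub>C x) = (c * d) *\<^sub>C x"
    and scaleR_scaleC: "r *\<^sub>R x = complex_of_real r *\<^sub>C x"
    and cinner_commute: "cinner x y = cnj (cinner y x)"
    and cinner_add_left: "cinner (x + y) z = cinner x z + cinner y z"
    and cinner_scaleC_left: "cinner (c *\<^sub>C x) y = c * cinner x y"
    and inner_Re_cinner: "x \<bullet> y = Re (cinner x y)"

instantiation complex :: complex_hilbert
begin

definition scaleC_complex :: "complex \<Rightarrow> complex \<Rightarrow> complex"
  where "scaleC_complex c x = c * x"

definition cinner_complex :: "complex \<Rightarrow> complex \<Rightarrow> complex"
  where "cinner_complex x y = x * cnj y"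

instance
  by standard
    (simp_all add: scaleC_complex_def cinner_complex_def algebra_simps scaleR_conv_of_real
      inner_complex_def)

end

lemma cinner_scaleC_right:
  fixes x y :: "'a::complex_hilbert"
  shows "cinner x (c *\<^sub>C y) = cnj c * cinner x y"
  by (metis cinner_commute cinner_scaleC_left complex_cnj_cnj complex_cnj_mult)

lemma norm_scaleC:
  fixes x :: "'a::complex_hilbert"
  shows "norm (c *\<^sub>C x) = cmod c * norm x"
proof -
  have "(c *\<^sub>C x) \<bullet> (c *\<^sub>C x) = Re ((c * cnj c) * cinner x x)"
    by (simp add: inner_Re_cinner cinner_scaleC_left cinner_scaleC_right algebra_simps)
  also have "\<dots> = (cmod c)\<^sup>2 * (x \<bullet> x)"
    by (simp only: inner_Re_cinner cmod_power2) (simp add: power2_eq_square algebra_simps)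
  finally show ?thesis
    by (simp add: norm_eq_sqrt_inner real_sqrt_mult)
qed

lemma bounded_linear_scaleC: "bounded_linear (scaleC c :: 'a::complex_hilbert \<Rightarrow> 'a)"
proof (rule bounded_linear_intro[where K = "cmod c"])
  fix r :: real and x y :: 'a
  show "c *\<^sub>C (x + y) = c *\<^sub>C x + c *\<^sub>C y"
    by (rule scaleC_add_right)
  show "c *\<^sub>C (r *\<^sub>R x) = r *\<^sub>R (c *\<^sub>C x)"
    by (simp add: scaleR_scaleC scaleC_scaleC mult.commute)
  show "norm (c *\<^sub>C x) \<le> norm x * cmod c"
    by (simp add: norm_scaleC mult.commute)
qed

section \<open>Bounded operators\<close>

text \<open>
  Operators are elements of \<open>'a \<Rightarrow>\<^sub>L 'a\<close>, which a priori are only real-linear. Self-adjointness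
  with respect to the complex inner product forces complex linearity (lemma
  \<open>self_adjoint_scaleC\<close>), and a two-sided inverse of a complex-linear operator is again
  complex-linear, so below invertibility and spectrum have their usual meaning.
\<close>

definition self_adjoint :: "('a::complex_hilbert \<Rightarrow>\<^sub>L 'a) \<Rightarrow> bool"
  where "self_adjoint A \<longleftrightarrow> (\<forall>x y. cinner (A x) y = cinner x (A y))"

lemma self_adjoint_scaleC:
  assumes "self_adjoint A"
  shows "blinfun_apply A (c *\<^sub>C x) = c *\<^sub>C A x"
proof -
  have "cinner (A (c *\<^sub>C x)) y = cinner (c *\<^sub>C A x) y" for y
    using assms by (simp add: self_adjoint_def cinner_scaleC_left)
  then have "A (c *\<^sub>C x) \<bullet> y = (c *\<^sub>C A x) \<bullet> y" for y
    by (simp add: inner_Re_cinner)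
  then show ?thesis
    by (metis vector_eq_rdot)
qed

definition positive_op :: "('a::complex_hilbert \<Rightarrow>\<^sub>L 'a) \<Rightarrow> bool"
  where "positive_op A \<longleftrightarrow> self_adjoint A \<and> (\<forall>x. Re (cinner (A x) x) \<ge> 0)"

definition op_le :: "('a::complex_hilbert \<Rightarrow>\<^sub>L 'a) \<Rightarrow> ('a \<Rightarrow>\<^sub>L 'a) \<Rightarrow> bool"
    (infix "\<sqsubseteq>" 50)
  where "X \<sqsubseteq> Y \<longleftrightarrow> self_adjoint X \<and> self_adjoint Y \<and> positive_op (Y - X)"

definition invertible_op :: "('a::complex_hilbert \<Rightarrow>\<^sub>L 'a) \<Rightarrow> bool"
  where "invertible_op A \<longleftrightarrow> (\<exists>S. A o\<^sub>L S = id_blinfun \<and> S o\<^sub>L A = id_blinfun)"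

definition scalar_op :: "complex \<Rightarrow> 'a::complex_hilbert \<Rightarrow>\<^sub>L 'a"
  where "scalar_op c = Blinfun (scaleC c)"

lemma scalar_op_apply [simp]: "blinfun_apply (scalar_op c) x = c *\<^sub>C x"
  by (simp add: scalar_op_def bounded_linear_Blinfun_apply bounded_linear_scaleC)

definition op_spectrum :: "('a::complex_hilbert \<Rightarrow>\<^sub>L 'a) \<Rightarrow> complex set"
  where "op_spectrum A = {z. \<not> invertible_op (A - scalar_op z)}"

section \<open>Continuous functional calculus\<close>

definition op_power :: "('a::complex_hilbert \<Rightarrow>\<^sub>L 'a) \<Rightarrow> nat \<Rightarrow> 'a \<Rightarrow>\<^sub>L 'a"
  where "op_power A n = ((\<lambda>X. A o\<^sub>L X) ^^ n) id_blinfun"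

definition poly_op :: "real poly \<Rightarrow> ('a::complex_hilbert \<Rightarrow>\<^sub>L 'a) \<Rightarrow> 'a \<Rightarrow>\<^sub>L 'a"
  where "poly_op p A = (\<Sum>i\<le>degree p. coeff p i *\<^sub>R op_power A i)"

text \<open>
  For self-adjoint \<open>A\<close>, whose spectrum is real, and real-valued \<open>f\<close> continuous on the spectrum:
  \<open>f(A)\<close> is the norm limit of \<open>p\<^sub>n(A)\<close> for every sequence of polynomials \<open>p\<^sub>n\<close> converging to \<open>f\<close>
  uniformly on the spectrum. Other \<open>A\<close> and \<open>f\<close> are outside the intended domain.
\<close>

definition fun_calc :: "(real \<Rightarrow> real) \<Rightarrow> ('a::complex_hilbert \<Rightarrow>\<^sub>L 'a) \<Rightarrow> 'a \<Rightarrow>\<^sub>L 'a"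
  where "fun_calc f A =
    (THE T. \<forall>p :: nat \<Rightarrow> real poly.
       uniform_limit {x. complex_of_real x \<in> op_spectrum A} (\<lambda>n x. poly (p n) x) f sequentially
         \<longrightarrow> (\<lambda>n. poly_op (p n) A) \<longlonglongrightarrow> T)"

definition op_powr :: "('a::complex_hilbert \<Rightarrow>\<^sub>L 'a) \<Rightarrow> real \<Rightarrow> 'a \<Rightarrow>\<^sub>L 'a"
  where "op_powr A r = fun_calc (\<lambda>x. x powr r) A"

section \<open>Tsallis relative operator entropy\<close>

definition tsallis_ln :: "real \<Rightarrow> real \<Rightarrow> real"
  where "tsallis_ln t x = (x powr t - 1) / t"

definition tsallis_entropy ::
    "real \<Rightarrow> ('a::complex_hilbert \<Rightarrow>\<^sub>L 'a) \<Rightarrow> ('a \<Rightarrow>\<^sub>L 'a) \<Rightarrow> 'a \<Rightarrow>\<^sub>L 'a"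
  where "tsallis_entropy t A B =
    op_powr A (1/2) o\<^sub>L
    fun_calc (tsallis_ln t) (op_powr A (-1/2) o\<^sub>L B o\<^sub>L op_powr A (-1/2)) o\<^sub>L
    op_powr A (1/2)"

definition eta :: "real \<Rightarrow> real \<Rightarrow> real"
  where "eta x a =
    (if x = 1 then 0 else (x powr a * ln x - tsallis_ln a x) / (a * tsallis_ln a x))"

lemma eta_tendsto_1:
  assumes "a > 0"
  shows "((\<lambda>x. eta x a) \<longlongrightarrow> 0) (at 1)"
proof -
  have "((\<lambda>x. (x powr a * ln x - (x powr a - 1) / a) / (a * ((x powr a - 1) / a))) \<longlongrightarrow> 0) (at 1)"
    using assms by real_asymp
  moreover have "eventually (\<lambda>x :: real. x \<noteq> 1) (at 1)"
    by (simp add: eventually_at_filter)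
  ultimately show ?thesis
    by (elim Lim_transform_eventually) (auto simp: eta_def tsallis_ln_def elim: eventually_mono)
qed

end

(* With C = A^(-1/2) B A^(-1/2) the hypothesis says m <= C <= M, so everything reduces to the scalar
   inequality for ln_s and ln_t on [m, M]. There eta x a is the derivative of ln (ln_a x) in a, and
   eta x a = L phi(a L) with L = ln x and phi(u) = 1 + 1/(e^u - 1) - 1/u, which is nonnegative and
   increasing since u <= 2 sinh(u/2); so eta is monotone in both arguments and the mean value
   theorem applies. The functional calculus is monotone because a real polynomial p that is
   nonnegative on the spectrum of a self-adjoint A gives p(A) >= 0: the minimum mu of the quadratic
   form of p(A) makes p(A) - mu singular, hence mu = p(x) for a spectral value x, by factoring
   p - mu into linear and quadratic real factors. *)

theory Submission
  imports Defs "HOL-Computational_Algebra.Fundamental_Theorem_Algebra"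
begin

text \<open>Completeness passes to the space of bounded operators, where the functional calculus
  takes its limits.\<close>

instance complex_hilbert \<subseteq> banach ..

section \<open>Self-adjointness expressed through the real inner product\<close>

section \<open>Self-adjoint operators\<close>

lemma blinfun_eq_iff: "f = g \<longleftrightarrow> (\<forall>x. blinfun_apply f x = blinfun_apply g x)"
  by (auto intro: blinfun_eqI)

text \<open>The imaginary part of \<open>cinner x y\<close> is the real inner product of -i x with
  y. Real symmetry together with complex linearity therefore recovers the full complex condition,
  and later arguments can stay with the real inner product.\<close>

lemma self_adjoint_iff:
  "self_adjoint A \<longleftrightarrow>
    (\<forall>x y. blinfun_apply A x \<bullet> y = x \<bullet> blinfun_apply A y) \<and>
    (\<forall>c x. blinfun_apply A (c *\<^sub>C x) = c *\<^sub>C blinfun_apply A x)"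
proof (intro iffI conjI allI)
  fix x y assume "self_adjoint A"
  then show "A x \<bullet> y = x \<bullet> A y"
    by (simp add: self_adjoint_def inner_Re_cinner)
next
  fix c x assume "self_adjoint A"
  then show "A (c *\<^sub>C x) = c *\<^sub>C A x"
    by (rule self_adjoint_scaleC)
next
  assume *: "(\<forall>x y. A x \<bullet> y = x \<bullet> A y) \<and> (\<forall>c x. A (c *\<^sub>C x) = c *\<^sub>C A x)"
  have Im: "Im (cinner x y) = ((-\<i>) *\<^sub>C x) \<bullet> y" for x y :: 'a
    by (simp add: inner_Re_cinner cinner_scaleC_left)
  show "self_adjoint A"
    unfolding self_adjoint_def
  proof (intro allI complex_eqI)
    fix x y
    show "Re (cinner (A x) y) = Re (cinner x (A y))"
      using * by (simp flip: inner_Re_cinner)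
    show "Im (cinner (A x) y) = Im (cinner x (A y))"
      using * unfolding Im by metis
  qed
qed

lemma self_adjoint_inner:
  "self_adjoint A \<Longrightarrow> blinfun_apply A x \<bullet> y = x \<bullet> blinfun_apply A y"
  by (simp add: self_adjoint_iff)

lemma self_adjoint_zero [simp]: "self_adjoint 0"
  by (simp add: self_adjoint_def zero_blinfun.rep_eq inner_Re_cinner)
     (metis cinner_commute cinner_scaleC_left complex_cnj_zero mult_zero_left of_real_0
       scaleR_scaleC scaleR_zero_left)

lemma self_adjoint_id [simp]: "self_adjoint id_blinfun"
  by (simp add: self_adjoint_def)

lemma self_adjoint_add:
  "self_adjoint A \<Longrightarrow> self_adjoint B \<Longrightarrow> self_adjoint (A + B)"
  by (simp add: self_adjoint_iff plus_blinfun.rep_eq inner_simps scaleC_add_right)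

lemma self_adjoint_scaleR:
  "self_adjoint A \<Longrightarrow> self_adjoint (r *\<^sub>R A)"
  by (simp add: self_adjoint_iff scaleR_blinfun.rep_eq)
     (simp add: scaleR_scaleC scaleC_scaleC mult.commute)

lemma self_adjoint_diff:
  "self_adjoint A \<Longrightarrow> self_adjoint B \<Longrightarrow> self_adjoint (A - B)"
  using self_adjoint_add[of A "(-1) *\<^sub>R B"] self_adjoint_scaleR[of B "-1"] by simp

lemma self_adjoint_sandwich:
  "self_adjoint H \<Longrightarrow> self_adjoint X \<Longrightarrow> self_adjoint (H o\<^sub>L X o\<^sub>L H)"
  by (simp add: self_adjoint_def)

text \<open>Both conditions of \<open>self_adjoint_iff\<close> survive pointwise limits. This is how
  self-adjointness passes from polynomials of an operator to the functional calculus.\<close>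

lemma self_adjoint_limit:
  fixes X :: "nat \<Rightarrow> 'a::complex_hilbert \<Rightarrow>\<^sub>L 'a"
  assumes "\<And>n. self_adjoint (X n)" and "X \<longlonglongrightarrow> T"
  shows "self_adjoint T"
  unfolding self_adjoint_iff
proof (intro conjI allI)
  have lim: "(\<lambda>n. X n x) \<longlonglongrightarrow> T x" for x
    by (intro tendsto_intros assms)
  fix x y
  have "(\<lambda>n. X n x \<bullet> y) \<longlonglongrightarrow> T x \<bullet> y"
    by (intro tendsto_intros lim)
  moreover have "(\<lambda>n. X n x \<bullet> y) \<longlonglongrightarrow> x \<bullet> T y"
    using assms(1) by (auto simp: self_adjoint_inner intro!: tendsto_intros lim)
  ultimately show "T x \<bullet> y = x \<bullet> T y"
    by (rule LIMSEQ_unique)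
  fix c
  have "(\<lambda>n. X n (c *\<^sub>C x)) \<longlonglongrightarrow> c *\<^sub>C T x"
    using bounded_linear.tendsto[OF bounded_linear_scaleC lim, of c x]
    by (simp add: self_adjoint_scaleC[OF assms(1)])
  with lim[of "c *\<^sub>C x"] show "T (c *\<^sub>C x) = c *\<^sub>C T x"
    by (rule LIMSEQ_unique)
qed

section \<open>Coercivity, invertibility and the location of the spectrum\<close>

section \<open>Invertibility and the real spectrum\<close>

lemma invertible_op_compose:
  assumes "invertible_op X" "invertible_op Y"
  shows "invertible_op (X o\<^sub>L Y)"
proof -
  obtain S R where S: "X o\<^sub>L S = id_blinfun" "S o\<^sub>L X = id_blinfun"
    and R: "Y o\<^sub>L R = id_blinfun" "R o\<^sub>L Y = id_blinfun"
    using assms by (auto simp: invertible_op_def)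
  have "X (S x) = x" "S (X x) = x" "Y (R x) = x" "R (Y x) = x" for x
    by (metis S R blinfun_apply_blinfun_compose id_blinfun.rep_eq id_apply)+
  then have "(X o\<^sub>L Y) o\<^sub>L (R o\<^sub>L S) = id_blinfun" "(R o\<^sub>L S) o\<^sub>L (X o\<^sub>L Y) = id_blinfun"
    by (auto intro!: blinfun_eqI)
  then show ?thesis
    unfolding invertible_op_def by blast
qed

text \<open>The Lax-Milgram argument: for a suitable step size e the map x - e (T x - b) is a
  contraction, and its fixed point solves T x = b. Coercivity then bounds the inverse by
  1/c.\<close>

lemma coercive_imp_invertible:
  fixes T :: "'a::complex_hilbert \<Rightarrow>\<^sub>L 'a"
  assumes "c > 0" and coercive: "\<And>x. c * (norm x)\<^sup>2 \<le> T x \<bullet> x"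
  shows "invertible_op T"
proof -
  define K where "K = norm T + c"
  have K: "K > 0" "c \<le> K" "norm (T x) \<le> K * norm x" for x
    using norm_blinfun[of T x] \<open>c > 0\<close> by (auto simp: K_def algebra_simps add_increasing add_pos_nonneg add_nonneg_pos)
  \<comment> \<open>This value minimises 1 - 2 e c + e^2 K^2, and the minimum is the squared
    contraction factor \<open>q\<close>. Adding c to the norm in \<open>K\<close> ensures c <= K, so
    the square root is real.\<close>
  define e where "e = c / K\<^sup>2"
  have e: "e > 0" using \<open>c > 0\<close> K by (simp add: e_def)
  define q where "q = sqrt (1 - c\<^sup>2 / K\<^sup>2)"
  have q2: "0 \<le> 1 - c\<^sup>2 / K\<^sup>2"
    using K \<open>c > 0\<close> by (simp add: power_mono)
  have q: "0 \<le> q" "q < 1"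
    using q2 K \<open>c > 0\<close> by (auto simp: q_def real_sqrt_lt_1_iff)
  have contr: "norm (x - e *\<^sub>R T x) \<le> q * norm x" for x
  proof -
    have "(norm (x - e *\<^sub>R T x))\<^sup>2 = (norm x)\<^sup>2 - 2 * e * (T x \<bullet> x) + e\<^sup>2 * (norm (T x))\<^sup>2"
      by (simp only: power2_norm_eq_inner inner_diff_left inner_diff_right inner_scaleR_left
          inner_scaleR_right inner_commute[of x "T x"]) (simp add: power2_eq_square algebra_simps)
    also have "\<dots> \<le> (norm x)\<^sup>2 - 2 * e * (c * (norm x)\<^sup>2) + e\<^sup>2 * (K * norm x)\<^sup>2"
      using coercive[of x] K e by (intro add_mono diff_mono mult_left_mono power_mono) auto
    also have "\<dots> = (1 - c\<^sup>2 / K\<^sup>2) * (norm x)\<^sup>2"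
      using K by (simp add: e_def field_simps power2_eq_square)
    also have "\<dots> = (q * norm x)\<^sup>2"
      using q2 by (simp add: q_def power_mult_distrib)
    finally show ?thesis
      by (rule power2_le_imp_le) (use q in simp)
  qed
  have ex1: "\<exists>!x. T x = b" for b
  proof -
    have "\<exists>!x. x - e *\<^sub>R (T x - b) = x"
    proof (rule banach_fix_type[OF q], intro allI)
      fix x y
      show "dist (x - e *\<^sub>R (T x - b)) (y - e *\<^sub>R (T y - b)) \<le> q * dist x y"
      proof -
        have "x - e *\<^sub>R (T x - b) - (y - e *\<^sub>R (T y - b)) = (x - y) - e *\<^sub>R T (x - y)"
          by (simp add: blinfun.diff_right scaleR_diff_right)
        then show ?thesis using contr[of "x - y"] by (simp only: dist_norm)
      qed
    qed
    then show ?thesis using e by simp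
  qed
  define S where "S b = (THE x. T x = b)" for b
  have TS: "T (S b) = b" for b
    unfolding S_def by (rule theI'[OF ex1])
  have ST: "S (T x) = x" for x
    using ex1 TS by blast
  have "bounded_linear S"
  proof (rule bounded_linear_intro[where K = "1 / c"])
    show "S (x + y) = S x + S y" for x y
      by (metis ST TS blinfun.add_right)
    show "S (r *\<^sub>R x) = r *\<^sub>R S x" for r x
      by (metis ST TS blinfun.scaleR_right)
    show "norm (S x) \<le> norm x * (1 / c)" for x
    proof (cases "S x = 0")
      case False
      have "c * (norm (S x))\<^sup>2 \<le> norm x * norm (S x)"
        using coercive[of "S x"] norm_cauchy_schwarz[of x "S x"] by (simp add: TS)
      then show ?thesis
        using False \<open>c > 0\<close> by (simp add: power2_eq_square field_simps)
    qed (use \<open>c > 0\<close> in simp)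
  qed
  then have "T o\<^sub>L Blinfun S = id_blinfun" "Blinfun S o\<^sub>L T = id_blinfun"
    by (auto intro!: blinfun_eqI simp: bounded_linear_Blinfun_apply TS ST)
  then show ?thesis
    unfolding invertible_op_def by blast
qed

lemma invertible_op_minus:
  assumes "invertible_op T"
  shows "invertible_op (- T)"
proof -
  obtain S where S: "T o\<^sub>L S = id_blinfun" "S o\<^sub>L T = id_blinfun"
    using assms by (auto simp: invertible_op_def)
  have "(- T) o\<^sub>L (- S) = id_blinfun" "(- S) o\<^sub>L (- T) = id_blinfun"
    using S by (auto simp: blinfun_eq_iff blinfun.bilinear_simps)
  then show ?thesis
    unfolding invertible_op_def by blast
qed

text \<open>Evaluating the form of \<open>S\<close> at \<open>x - S x / N\<close> with \<open>N > \<parallel>S\<parallel>\<close> gives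
  \<open>\<parallel>S x\<parallel>\<^sup>2 \<le> N \<langle>S x, x\<rangle>\<close>; invertibility bounds the left side below.\<close>

lemma positive_invertible_imp_coercive:
  fixes S :: "'a::complex_hilbert \<Rightarrow>\<^sub>L 'a"
  assumes "positive_op S" and "invertible_op S"
  shows "\<exists>c>0. \<forall>x. c * (norm x)\<^sup>2 \<le> S x \<bullet> x"
proof -
  have sa: "self_adjoint S" and pos: "\<And>x. 0 \<le> S x \<bullet> x"
    using assms(1) by (auto simp: positive_op_def inner_Re_cinner)
  define N where "N = norm S + 1"
  have N: "N > 0" "norm (S x) \<le> N * norm x" for x
    using norm_blinfun[of S x] norm_ge_zero[of S] norm_ge_zero[of x]
    unfolding N_def distrib_right by linarith+
  have *: "(norm (S x))\<^sup>2 \<le> N * (S x \<bullet> x)" for x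
  proof -
    define y where "y = S x"
    define r where "r = - 1 / N"
    have "0 \<le> S (x + r *\<^sub>R y) \<bullet> (x + r *\<^sub>R y)"
      by (rule pos)
    also have "\<dots> = S x \<bullet> x + 2 * r * (norm y)\<^sup>2 + r\<^sup>2 * (S y \<bullet> y)"
      using self_adjoint_inner[OF sa, of y x]
      by (simp add: blinfun.bilinear_simps inner_simps power2_norm_eq_inner
          algebra_simps inner_commute flip: y_def) (simp add: power2_eq_square)
    also have "\<dots> \<le> S x \<bullet> x + 2 * r * (norm y)\<^sup>2 + r\<^sup>2 * (N * (norm y)\<^sup>2)"
    proof -
      have "S y \<bullet> y \<le> N * norm y * norm y"
        using norm_cauchy_schwarz[of "S y" y] N(2)[of y] by (meson mult_right_mono norm_ge_zero order_trans)
      then have "r\<^sup>2 * (S y \<bullet> y) \<le> r\<^sup>2 * (N * (norm y)\<^sup>2)"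
        by (intro mult_left_mono) (auto simp: power2_eq_square mult.assoc)
      then show ?thesis by simp
    qed
    also have "\<dots> = S x \<bullet> x - (norm y)\<^sup>2 / N"
      using N(1) by (simp add: r_def power2_eq_square field_simps)
    finally show ?thesis
      using N(1) by (simp add: y_def field_simps)
  qed
  obtain R where R: "R o\<^sub>L S = id_blinfun"
    using assms(2) by (auto simp: invertible_op_def)
  \<comment> \<open>Combines the bound on the norm of S x with the norm of x being at most (norm R +
    1) times that of S x. The added 1 keeps the denominator positive even on the zero space.\<close>
  define c where "c = 1 / ((norm R + 1)\<^sup>2 * N)"
  have nR: "norm R + 1 > 0" by (simp add: add_nonneg_pos)
  have "c > 0" using N(1) nR by (simp add: c_def)
  moreover have "c * (norm x)\<^sup>2 \<le> S x \<bullet> x" for x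
  proof -
    have "norm x = norm (R (S x))"
      by (metis R blinfun_apply_blinfun_compose id_blinfun.rep_eq id_apply)
    also have "\<dots> \<le> (norm R + 1) * norm (S x)"
      using norm_blinfun[of R "S x"] by (simp add: algebra_simps add_increasing)
    finally have "(norm x)\<^sup>2 \<le> (norm R + 1)\<^sup>2 * (norm (S x))\<^sup>2"
      by (metis norm_ge_zero power_mono power_mult_distrib)
    also have "\<dots> \<le> (norm R + 1)\<^sup>2 * (N * (S x \<bullet> x))"
      by (intro mult_left_mono *) simp
    finally show ?thesis
      using N(1) nR by (simp add: c_def field_simps)
  qed
  ultimately show ?thesis by blast
qed

text \<open>Names the set on which \<open>fun_calc\<close> demands uniform convergence.\<close>

definition real_spectrum :: "('a::complex_hilbert \<Rightarrow>\<^sub>L 'a) \<Rightarrow> real set"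
  where "real_spectrum A = {x. complex_of_real x \<in> op_spectrum A}"

lemma real_spectrum_iff:
  "x \<in> real_spectrum A \<longleftrightarrow> \<not> invertible_op (A - x *\<^sub>R id_blinfun)"
proof -
  have "scalar_op (complex_of_real x) = x *\<^sub>R (id_blinfun :: 'a \<Rightarrow>\<^sub>L 'a)"
    by (intro blinfun_eqI) (simp add: scaleR_blinfun.rep_eq scaleR_scaleC)
  then show ?thesis
    by (simp add: real_spectrum_def op_spectrum_def)
qed

text \<open>For l below a the operator A - l is coercive, and for l above b its negative is; both
  are then invertible.\<close>

lemma real_spectrum_subset:
  assumes lo: "\<And>x. a * (norm x)\<^sup>2 \<le> blinfun_apply A x \<bullet> x"
    and up: "\<And>x. blinfun_apply A x \<bullet> x \<le> b * (norm x)\<^sup>2"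
  shows "real_spectrum A \<subseteq> {a..b}"
proof
  fix l assume l: "l \<in> real_spectrum A"
  have "\<not> l < a"
  proof
    assume "l < a"
    then have "invertible_op (A - l *\<^sub>R id_blinfun)"
      using lo by (intro coercive_imp_invertible[of "a - l"])
        (auto simp: blinfun.bilinear_simps inner_simps power2_norm_eq_inner algebra_simps)
    with l show False by (simp add: real_spectrum_iff)
  qed
  moreover have "\<not> b < l"
  proof
    assume "b < l"
    then have "invertible_op (- (A - l *\<^sub>R id_blinfun))"
      using up by (intro coercive_imp_invertible[of "l - b"])
        (auto simp: blinfun.bilinear_simps inner_simps power2_norm_eq_inner algebra_simps)
    from invertible_op_minus[OF this] l show False by (simp add: real_spectrum_iff)
  qed
  ultimately show "l \<in> {a..b}" by auto
qed

lemma quadratic_form_le_norm: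
  "\<bar>blinfun_apply A x \<bullet> x\<bar> \<le> norm A * (norm x)\<^sup>2"
  using Cauchy_Schwarz_ineq2[of "A x" x] mult_right_mono[OF norm_blinfun[of A x], of "norm x"]
  by (simp add: power2_eq_square mult.assoc)

section \<open>Algebra of real polynomials evaluated at an operator\<close>

section \<open>Polynomials of an operator\<close>

lemma poly_op_0 [simp]: "poly_op 0 A = 0"
  by (simp add: poly_op_def)

text \<open>Horner's recursion, which opens all later polynomial identities to induction. The zero
  polynomial is split off because \<open>pCons\<close> does not raise its degree.\<close>

lemma poly_op_pCons [simp]:
  "poly_op (pCons a p) A = a *\<^sub>R id_blinfun + (A o\<^sub>L poly_op p A)"
proof (cases "p = 0")
  case True
  then show ?thesis by (simp add: poly_op_def op_power_def)
next
  case False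
  have "(\<Sum>i\<le>degree p. coeff p i *\<^sub>R op_power A (Suc i)) = (A o\<^sub>L poly_op p A)"
    by (intro blinfun_eqI)
      (simp only: poly_op_def op_power_def funpow.simps o_apply blinfun.sum_left blinfun.sum_right
        blinfun.scaleR_left blinfun.scaleR_right blinfun_apply_blinfun_compose)
  moreover have "poly_op (pCons a p) A =
      a *\<^sub>R op_power A 0 + (\<Sum>i\<le>degree p. coeff p i *\<^sub>R op_power A (Suc i))"
    unfolding poly_op_def degree_pCons_eq[OF False] sum.atMost_Suc_shift by simp
  ultimately show ?thesis
    by (simp add: op_power_def)
qed

lemma poly_op_add: "poly_op (p + q) A = poly_op p A + poly_op q A"
proof (induction p q rule: poly_induct2)
  case 0
  then show ?case by simp
next
  case (pCons a p b q)
  then show ?case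
    by (simp add: blinfun_eq_iff blinfun.bilinear_simps algebra_simps)
qed

lemma poly_op_smult: "poly_op (smult r p) A = r *\<^sub>R poly_op p A"
  by (induction p) (simp_all add: blinfun_eq_iff blinfun.bilinear_simps algebra_simps)

lemma poly_op_diff: "poly_op (p - q) A = poly_op p A - poly_op q A"
  using poly_op_add[of p "smult (-1) q" A] poly_op_smult[of "-1" q A] by simp

lemma poly_op_mult: "poly_op (p * q) A = (poly_op p A o\<^sub>L poly_op q A)"
  by (induction p)
    (simp_all add: poly_op_add poly_op_smult blinfun_eq_iff blinfun.bilinear_simps)

lemma poly_op_commute: "(poly_op p A o\<^sub>L poly_op q A) = (poly_op q A o\<^sub>L poly_op p A)"
  by (metis mult.commute poly_op_mult)

text \<open>In the Horner step the product of A and p(A) is self-adjoint because the two factors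
  commute.\<close>

lemma self_adjoint_poly_op:
  assumes "self_adjoint A"
  shows "self_adjoint (poly_op p A)"
proof (induction p)
  case (pCons a p)
  have "(A o\<^sub>L poly_op p A) = (poly_op p A o\<^sub>L A)"
    using poly_op_commute[of "[:0, 1:]" A p] by (simp add: blinfun_eq_iff blinfun.bilinear_simps)
  then have "A (poly_op p A x) = poly_op p A (A x)" for x
    by (metis blinfun_apply_blinfun_compose)
  then have "self_adjoint (A o\<^sub>L poly_op p A)"
    using assms pCons by (simp add: self_adjoint_def)
  then show ?case
    by (simp add: self_adjoint_add self_adjoint_scaleR)
qed simp

section \<open>Real factorisation through complex roots, and invertibility of p(A)\<close>

lemma poly_map_of_real_add:
  "poly (map_poly complex_of_real (p + q)) z =
    poly (map_poly of_real p) z + poly (map_poly of_real q) z"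
  by (induction p q rule: poly_induct2) (simp_all add: map_poly_pCons algebra_simps)

lemma poly_map_of_real_smult:
  "poly (map_poly complex_of_real (smult r p)) z = of_real r * poly (map_poly of_real p) z"
  by (induction p) (simp_all add: map_poly_pCons algebra_simps)

lemma poly_map_of_real_mult:
  "poly (map_poly complex_of_real (p * q)) z =
    poly (map_poly of_real p) z * poly (map_poly of_real q) z"
  by (induction p)
    (simp_all add: map_poly_pCons poly_map_of_real_add poly_map_of_real_smult algebra_simps)

lemma poly_map_of_real_of_real:
  "poly (map_poly complex_of_real p) (of_real x) = of_real (poly p x)"
  by (induction p) (simp_all add: map_poly_pCons)

text \<open>The divisor is (X - z)(X - cnj z). The remainder has degree at most 1 and real
  coefficients, yet vanishes at the nonreal z, so it is zero.\<close>

lemma real_quadratic_dvd: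
  fixes p :: "real poly"
  assumes root: "poly (map_poly complex_of_real p) z = 0" and "Im z \<noteq> 0"
  shows "[:(Re z)\<^sup>2 + (Im z)\<^sup>2, - 2 * Re z, 1:] dvd p"
proof -
  define q where "q = [:(Re z)\<^sup>2 + (Im z)\<^sup>2, - 2 * Re z, 1:]"
  have q: "q \<noteq> 0" "degree q = 2"
    by (simp_all add: q_def)
  have qz: "poly (map_poly complex_of_real q) z = 0"
    by (simp add: q_def map_poly_pCons complex_eq_iff power2_eq_square algebra_simps)
  define r where "r = p mod q"
  have "degree r < 2"
    using degree_mod_less[of q p] q by (auto simp: r_def)
  moreover obtain c r' where r': "r = pCons c r'"
    by (rule pCons_cases)
  ultimately have "degree r' = 0"
    by (cases "r' = 0") auto
  then obtain d where r: "r = [:c, d:]"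
    using r' by (auto elim: degree_eq_zeroE)
  have "p = q * (p div q) + r"
    by (simp add: r_def)
  then have "poly (map_poly complex_of_real r) z = 0"
    using root qz poly_map_of_real_add[of "q * (p div q)" r z] poly_map_of_real_mult[of q "p div q" z]
    by simp
  then have "d = 0" "c = 0"
    using \<open>Im z \<noteq> 0\<close> by (auto simp: r map_poly_pCons complex_eq_iff)
  then have "p mod q = 0"
    using r by (simp add: r_def)
  then show ?thesis
    unfolding q_def by (rule mod_0_imp_dvd)
qed

text \<open>Induction on the degree, splitting off one factor per complex root z. A real root gives
  A - z, invertible since z lies off the spectrum. A nonreal root gives the quadratic (A - Re z)^2 +
  (Im z)^2, which is coercive by self-adjointness.\<close>

lemma invertible_poly_op:
  fixes A :: "'a::complex_hilbert \<Rightarrow>\<^sub>L 'a"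
  assumes sa: "self_adjoint A" and "p \<noteq> 0" and "\<And>x. x \<in> real_spectrum A \<Longrightarrow> poly p x \<noteq> 0"
  shows "invertible_op (poly_op p A)"
  using assms(2,3)
proof (induction "degree p" arbitrary: p rule: less_induct)
  case less
  show ?case
  proof (cases "degree p = 0")
    case True
    then obtain c where p: "p = [:c:]" "c \<noteq> 0"
      using less.prems by (metis degree_eq_zeroE pCons_0_0)
    then have "poly_op p A o\<^sub>L (1 / c) *\<^sub>R id_blinfun = id_blinfun"
      "(1 / c) *\<^sub>R id_blinfun o\<^sub>L poly_op p A = id_blinfun"
      by (auto simp: blinfun_eq_iff blinfun.bilinear_simps)
    then show ?thesis
      unfolding invertible_op_def by blast
  next
    case False
    then have "degree (map_poly complex_of_real p) \<noteq> 0"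
      by (simp add: degree_map_poly)
    then have "\<not> constant (poly (map_poly complex_of_real p))"
      by (simp add: constant_degree)
    then obtain z where z: "poly (map_poly complex_of_real p) z = 0"
      using fundamental_theorem_of_algebra by blast
    have "\<exists>q. q dvd p \<and> degree q > 0 \<and> invertible_op (poly_op q A)"
    proof (cases "Im z = 0")
      case True
      then have "poly p (Re z) = 0"
        using z poly_map_of_real_of_real[of p "Re z"] by (simp add: complex_is_Real_iff)
      then have "Re z \<notin> real_spectrum A" "[:- Re z, 1:] dvd p"
        using less.prems poly_eq_0_iff_dvd by blast+
      moreover have "poly_op [:- Re z, 1:] A = A - Re z *\<^sub>R id_blinfun"
        by (simp add: blinfun_eq_iff blinfun.bilinear_simps)
      ultimately show ?thesis
        by (intro exI[of _ "[:- Re z, 1:]"]) (simp add: real_spectrum_iff)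
    next
      case False
      define q where "q = [:(Re z)\<^sup>2 + (Im z)\<^sup>2, - 2 * Re z, 1:]"
      have "(Im z)\<^sup>2 * (norm x)\<^sup>2 \<le> poly_op q A x \<bullet> x" for x
      proof -
        have "poly_op q A x \<bullet> x =
            (norm (A x - Re z *\<^sub>R x))\<^sup>2 + (Im z)\<^sup>2 * (norm x)\<^sup>2"
          using self_adjoint_inner[OF sa, of "A x" x]
          by (simp add: q_def blinfun.bilinear_simps power2_norm_eq_inner inner_simps
              algebra_simps inner_commute) (simp add: power2_eq_square algebra_simps)
        then show ?thesis by simp
      qed
      then have "invertible_op (poly_op q A)"
        using False by (intro coercive_imp_invertible[of "(Im z)\<^sup>2"]) auto
      then show ?thesis
        using real_quadratic_dvd[OF z False] by (intro exI[of _ q]) (simp add: q_def)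
    qed
    then obtain q k where q: "p = q * k" "degree q > 0" "invertible_op (poly_op q A)"
      by (auto elim: dvdE)
    then have "k \<noteq> 0" "degree k < degree p"
      using less.prems by (auto simp: degree_mult_eq)
    then have "invertible_op (poly_op k A)"
      using less.prems q by (intro less.hyps) auto
    then show ?thesis
      using q by (simp add: poly_op_mult invertible_op_compose)
  qed
qed

section \<open>Positivity and norm bounds for p(A) from the values of p on the spectrum\<close>

text \<open>The infimum \<open>\<mu>\<close> of the quadratic form on the unit sphere: were \<open>T - \<mu>\<close> invertible, it would be
  coercive and \<open>\<mu>\<close> could be increased.\<close>

lemma real_spectrum_minimum:
  fixes T :: "'a::complex_hilbert \<Rightarrow>\<^sub>L 'a" and x :: 'a
  assumes sa: "self_adjoint T" and "x \<noteq> 0"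
  shows "\<exists>mu\<in>real_spectrum T. \<forall>y. mu * (norm y)\<^sup>2 \<le> T y \<bullet> y"
proof -
  define U where "U = (\<lambda>u. T u \<bullet> u) ` {u. norm u = 1}"
  have bdd: "bdd_below U"
  proof (rule bdd_belowI)
    fix v assume "v \<in> U"
    then obtain u where "norm u = 1" "v = T u \<bullet> u" by (auto simp: U_def)
    then show "- norm T \<le> v"
      using quadratic_form_le_norm[of T u] by simp
  qed
  have scaled: "T ((1 / norm y) *\<^sub>R y) \<bullet> ((1 / norm y) *\<^sub>R y) = (T y \<bullet> y) / (norm y)\<^sup>2" for y
    by (simp add: blinfun.bilinear_simps power2_eq_square)
  have inU: "(T y \<bullet> y) / (norm y)\<^sup>2 \<in> U" if "y \<noteq> 0" for y
    unfolding U_def scaled[symmetric] using that by (intro imageI) simp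
  define mu where "mu = Inf U"
  have mu: "mu * (norm y)\<^sup>2 \<le> T y \<bullet> y" for y
  proof (cases "y = 0")
    case False
    have "mu \<le> (T y \<bullet> y) / (norm y)\<^sup>2"
      unfolding mu_def using inU False bdd by (intro cInf_lower) auto
    then show ?thesis using False by (simp add: field_simps)
  qed simp
  define S where "S = T - mu *\<^sub>R id_blinfun"
  have pos: "positive_op S"
    unfolding positive_op_def
  proof
    show "self_adjoint S"
      unfolding S_def by (intro self_adjoint_diff self_adjoint_scaleR sa self_adjoint_id)
    show "\<forall>x. 0 \<le> Re (cinner (S x) x)"
      using mu by (simp add: S_def blinfun.bilinear_simps inner_simps power2_norm_eq_inner
          flip: inner_Re_cinner)
  qed
  have "\<not> invertible_op S"
  proof
    assume "invertible_op S"
    with pos obtain c where c: "c > 0" "\<And>y. c * (norm y)\<^sup>2 \<le> S y \<bullet> y"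
      using positive_invertible_imp_coercive by blast
    have "mu + c \<le> Inf U"
    proof (rule cInf_greatest)
      show "U \<noteq> {}" using inU[OF \<open>x \<noteq> 0\<close>] by auto
      fix v assume "v \<in> U"
      then obtain u where "norm u = 1" "v = T u \<bullet> u" by (auto simp: U_def)
      then show "mu + c \<le> v"
        using c(2)[of u]
        by (simp add: S_def blinfun.diff_left blinfun.scaleR_left inner_diff_left dot_square_norm)
    qed
    then show False using \<open>c > 0\<close> by (simp add: mu_def)
  qed
  then show ?thesis
    unfolding S_def real_spectrum_iff[symmetric] using mu by blast
qed

lemma poly_op_nonneg:
  fixes A :: "'a::complex_hilbert \<Rightarrow>\<^sub>L 'a"
  assumes sa: "self_adjoint A" and nonneg: "\<And>x. x \<in> real_spectrum A \<Longrightarrow> 0 \<le> poly p x"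
  shows "0 \<le> poly_op p A x \<bullet> x"
proof (cases "x = 0")
  case False
  obtain mu where mu: "mu \<in> real_spectrum (poly_op p A)"
      "\<And>y. mu * (norm y)\<^sup>2 \<le> poly_op p A y \<bullet> y"
    using real_spectrum_minimum[OF self_adjoint_poly_op[OF sa] False] by blast
  have "poly_op (p - [:mu:]) A = poly_op p A - mu *\<^sub>R id_blinfun"
    by (simp add: poly_op_diff)
  then have "\<not> invertible_op (poly_op (p - [:mu:]) A)"
    using mu(1) by (simp add: real_spectrum_iff)
  then have "p - [:mu:] = 0 \<or> (\<exists>y\<in>real_spectrum A. poly p y = mu)"
    using invertible_poly_op[OF sa, of "p - [:mu:]"] by auto
  \<comment> \<open>Needed when p is the constant mu: its sign is known only through some spectral
    point.\<close>
  moreover have "real_spectrum A \<noteq> {}"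
    using real_spectrum_minimum[OF sa False] by blast
  ultimately have "0 \<le> mu"
    using nonneg by force
  then have "0 \<le> mu * (norm x)\<^sup>2" by simp
  with mu(2)[of x] show ?thesis by (rule order_trans[rotated])
qed simp

text \<open>Positivity applied to c^2 - p^2, whose quadratic form at x is c^2 times the squared norm
  of x minus the squared norm of p(A) x.\<close>

lemma norm_poly_op_le:
  fixes A :: "'a::complex_hilbert \<Rightarrow>\<^sub>L 'a"
  assumes sa: "self_adjoint A" and "0 \<le> c" and le: "\<And>x. x \<in> real_spectrum A \<Longrightarrow> \<bar>poly p x\<bar> \<le> c"
  shows "norm (poly_op p A) \<le> c"
proof (rule norm_blinfun_bound[OF \<open>0 \<le> c\<close>])
  fix x
  have "0 \<le> poly_op ([:c\<^sup>2:] - p * p) A x \<bullet> x"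
  proof (rule poly_op_nonneg[OF sa])
    fix y assume "y \<in> real_spectrum A"
    from power_mono[OF le[OF this], of 2] show "0 \<le> poly ([:c\<^sup>2:] - p * p) y"
      by (simp flip: power2_eq_square)
  qed
  also have "\<dots> = (c * norm x)\<^sup>2 - (norm (poly_op p A x))\<^sup>2"
    using self_adjoint_inner[OF self_adjoint_poly_op[OF sa], of p "poly_op p A x" x]
    by (simp add: poly_op_diff poly_op_mult blinfun.bilinear_simps inner_simps
        power_mult_distrib power2_norm_eq_inner)
  finally show "norm (poly_op p A x) \<le> c * norm x"
    by (intro power2_le_imp_le[OF _ mult_nonneg_nonneg[OF \<open>0 \<le> c\<close> norm_ge_zero]]) linarith
qed

section \<open>Existence, linearity and positivity of the functional calculus\<close>

section \<open>Continuous functional calculus\<close>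

lemma Weierstrass_uniform_limit_poly:
  fixes f :: "real \<Rightarrow> real"
  assumes "continuous_on {a..b} f"
  shows "\<exists>p. uniform_limit {a..b} (\<lambda>n x. poly (p n) x) f sequentially"
proof -
  have "\<exists>p. \<forall>x\<in>{a..b}. \<bar>f x - poly p x\<bar> < inverse (real (Suc n))" for n
  proof -
    obtain g where g: "real_polynomial_function g"
        "\<And>x. x \<in> {a..b} \<Longrightarrow> \<bar>f x - g x\<bar> < inverse (real (Suc n))"
      by (rule Stone_Weierstrass_real_polynomial_function[OF compact_Icc assms,
            of "inverse (real (Suc n))"]) auto
    obtain c k where "g = (\<lambda>x. \<Sum>i\<le>k. c i * x ^ i)"
      using g(1) real_polynomial_function_iff_sum by blast
    then have "g x = poly (\<Sum>i\<le>k. monom (c i) i) x" for x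
      by (simp add: poly_sum poly_monom)
    with g(2) show ?thesis by metis
  qed
  then obtain p where p: "\<And>n x. x \<in> {a..b} \<Longrightarrow> \<bar>f x - poly (p n) x\<bar> < inverse (real (Suc n))"
    by metis
  have "uniform_limit {a..b} (\<lambda>n x. poly (p n) x) f sequentially"
  proof (rule uniform_limitI)
    fix e :: real assume "e > 0"
    have "\<forall>\<^sub>F n in sequentially. inverse (real (Suc n)) < e"
      using order_tendstoD(2)[OF LIMSEQ_inverse_real_of_nat \<open>e > 0\<close>] .
    then show "\<forall>\<^sub>F n in sequentially. \<forall>x\<in>{a..b}. dist (poly (p n) x) (f x) < e"
    proof eventually_elim
      case (elim n)
      then show ?case using p[of _ n] by (force simp: dist_real_def abs_minus_commute)
    qed
  qed
  then show ?thesis by blast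
qed

text \<open>By \<open>norm_poly_op_le\<close>, uniform closeness on the spectrum becomes closeness
  in operator norm, so one approximating sequence is Cauchy and all others share its limit. The
  second claim makes that limit unique: with no approximating sequence the condition on T would be
  vacuous.\<close>

lemma poly_op_tendsto_fun_calc_aux:
  fixes A :: "'a::complex_hilbert \<Rightarrow>\<^sub>L 'a"
  assumes sa: "self_adjoint A" and sub: "real_spectrum A \<subseteq> {a..b}" and cont: "continuous_on {a..b} f"
  shows "\<exists>T. \<forall>p. uniform_limit (real_spectrum A) (\<lambda>n x. poly (p n) x) f sequentially
    \<longrightarrow> (\<lambda>n. poly_op (p n) A) \<longlonglongrightarrow> T"
    and "\<exists>p. uniform_limit (real_spectrum A) (\<lambda>n x. poly (p n) x) f sequentially"
proof -
  obtain q where q: "uniform_limit (real_spectrum A) (\<lambda>n x. poly (q n) x) f sequentially"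
    using Weierstrass_uniform_limit_poly[OF cont] uniform_limit_on_subset[OF _ sub] by blast
  then show "\<exists>p. uniform_limit (real_spectrum A) (\<lambda>n x. poly (p n) x) f sequentially"
    by blast
  have "Cauchy (\<lambda>n. poly_op (q n) A)"
  proof (rule metric_CauchyI)
    fix e :: real assume "e > 0"
    then have "\<forall>\<^sub>F n in sequentially. \<forall>x\<in>real_spectrum A. dist (poly (q n) x) (f x) < e / 4"
      by (intro uniform_limitD[OF q]) simp
    then obtain N where N: "\<And>n x. n \<ge> N \<Longrightarrow> x \<in> real_spectrum A \<Longrightarrow> dist (poly (q n) x) (f x) < e / 4"
      by (auto simp: eventually_sequentially)
    have "dist (poly_op (q m) A) (poly_op (q n) A) < e" if "m \<ge> N" "n \<ge> N" for m n
    proof -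
      \<comment> \<open>Two errors of e/4 leave e/2, because the norm bound is not strict.\<close>
      have "norm (poly_op (q m - q n) A) \<le> e / 2"
      proof (rule norm_poly_op_le[OF sa])
        fix x assume x: "x \<in> real_spectrum A"
        show "\<bar>poly (q m - q n) x\<bar> \<le> e / 2"
          using N[OF that(1) x] N[OF that(2) x] unfolding dist_real_def poly_diff by linarith
      qed (use \<open>e > 0\<close> in simp)
      with \<open>e > 0\<close> show ?thesis by (simp add: poly_op_diff dist_norm)
    qed
    then show "\<exists>N. \<forall>m\<ge>N. \<forall>n\<ge>N. dist (poly_op (q m) A) (poly_op (q n) A) < e"
      by blast
  qed
  then obtain T where T: "(\<lambda>n. poly_op (q n) A) \<longlonglongrightarrow> T"
    using Cauchy_convergent convergent_def by blast
  have "(\<lambda>n. poly_op (p n) A) \<longlonglongrightarrow> T"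
    if p: "uniform_limit (real_spectrum A) (\<lambda>n x. poly (p n) x) f sequentially" for p
  proof -
    have "(\<lambda>n. poly_op (p n) A - poly_op (q n) A) \<longlonglongrightarrow> 0"
    proof (rule metric_LIMSEQ_I)
      fix e :: real assume "e > 0"
      then have "\<forall>\<^sub>F n in sequentially. \<forall>x\<in>real_spectrum A. dist (poly (q n) x) (f x) < e / 4"
        "\<forall>\<^sub>F n in sequentially. \<forall>x\<in>real_spectrum A. dist (poly (p n) x) (f x) < e / 4"
        by (intro uniform_limitD[OF q] uniform_limitD[OF p]; simp)+
      then have "\<forall>\<^sub>F n in sequentially. dist (poly_op (p n) A - poly_op (q n) A) 0 < e"
      proof eventually_elim
        case (elim n)
        have "norm (poly_op (p n - q n) A) \<le> e / 2"
        proof (rule norm_poly_op_le[OF sa])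
          fix x assume x: "x \<in> real_spectrum A"
          show "\<bar>poly (p n - q n) x\<bar> \<le> e / 2"
            using elim(1)[rule_format, OF x] elim(2)[rule_format, OF x]
            unfolding dist_real_def poly_diff by linarith
        qed (use \<open>e > 0\<close> in simp)
        with \<open>e > 0\<close> show ?case by (simp add: poly_op_diff)
      qed
      then show "\<exists>N. \<forall>n\<ge>N. dist (poly_op (p n) A - poly_op (q n) A) 0 < e"
        by (simp add: eventually_sequentially)
    qed
    from tendsto_add[OF this T] show ?thesis by simp
  qed
  then show "\<exists>T. \<forall>p. uniform_limit (real_spectrum A) (\<lambda>n x. poly (p n) x) f sequentially
    \<longrightarrow> (\<lambda>n. poly_op (p n) A) \<longlonglongrightarrow> T" by blast
qed

lemma poly_op_tendsto_fun_calc: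
  fixes A :: "'a::complex_hilbert \<Rightarrow>\<^sub>L 'a"
  assumes sa: "self_adjoint A" and sub: "real_spectrum A \<subseteq> {a..b}" and cont: "continuous_on {a..b} f"
    and p: "uniform_limit (real_spectrum A) (\<lambda>n x. poly (p n) x) f sequentially"
  shows "(\<lambda>n. poly_op (p n) A) \<longlonglongrightarrow> fun_calc f A"
proof -
  let ?P = "\<lambda>T. \<forall>p. uniform_limit (real_spectrum A) (\<lambda>n x. poly (p n) x) f sequentially
    \<longrightarrow> (\<lambda>n. poly_op (p n) A) \<longlonglongrightarrow> T"
  note ex = poly_op_tendsto_fun_calc_aux[OF sa sub cont]
  have "\<exists>!T. ?P T"
    using ex LIMSEQ_unique by metis
  from theI'[OF this] show ?thesis
    using p unfolding fun_calc_def real_spectrum_def by blast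
qed

lemma fun_calc_eqI:
  fixes A :: "'a::complex_hilbert \<Rightarrow>\<^sub>L 'a"
  assumes "self_adjoint A" and "real_spectrum A \<subseteq> {a..b}" and "continuous_on {a..b} f"
    and "uniform_limit (real_spectrum A) (\<lambda>n x. poly (p n) x) f sequentially"
    and "(\<lambda>n. poly_op (p n) A) \<longlonglongrightarrow> T"
  shows "fun_calc f A = T"
  using LIMSEQ_unique[OF poly_op_tendsto_fun_calc[OF assms(1-4)] assms(5)] .

lemma fun_calc_obtain_poly:
  fixes A :: "'a::complex_hilbert \<Rightarrow>\<^sub>L 'a"
  assumes "self_adjoint A" and "real_spectrum A \<subseteq> {a..b}" and "continuous_on {a..b} f"
  obtains p where "uniform_limit (real_spectrum A) (\<lambda>n x. poly (p n) x) f sequentially"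
    and "(\<lambda>n. poly_op (p n) A) \<longlonglongrightarrow> fun_calc f A"
  using poly_op_tendsto_fun_calc_aux(2)[OF assms] poly_op_tendsto_fun_calc[OF assms] by blast

lemma self_adjoint_fun_calc:
  fixes A :: "'a::complex_hilbert \<Rightarrow>\<^sub>L 'a"
  assumes "self_adjoint A" and "real_spectrum A \<subseteq> {a..b}" and "continuous_on {a..b} f"
  shows "self_adjoint (fun_calc f A)"
  using fun_calc_obtain_poly[OF assms] self_adjoint_limit self_adjoint_poly_op[OF assms(1)] by metis

lemma fun_calc_linear:
  fixes A :: "'a::complex_hilbert \<Rightarrow>\<^sub>L 'a"
  assumes "self_adjoint A" and "real_spectrum A \<subseteq> {a..b}"
    and "continuous_on {a..b} f" and "continuous_on {a..b} g"
  shows "fun_calc (\<lambda>x. c * f x + d * g x) A = c *\<^sub>R fun_calc f A + d *\<^sub>R fun_calc g A"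
proof -
  obtain p where p: "uniform_limit (real_spectrum A) (\<lambda>n x. poly (p n) x) f sequentially"
    "(\<lambda>n. poly_op (p n) A) \<longlonglongrightarrow> fun_calc f A"
    by (rule fun_calc_obtain_poly[OF assms(1,2,3)])
  obtain q where q: "uniform_limit (real_spectrum A) (\<lambda>n x. poly (q n) x) g sequentially"
    "(\<lambda>n. poly_op (q n) A) \<longlonglongrightarrow> fun_calc g A"
    by (rule fun_calc_obtain_poly[OF assms(1,2,4)])
  show ?thesis
  proof (rule fun_calc_eqI[OF assms(1,2), where p = "\<lambda>n. smult c (p n) + smult d (q n)"])
    show "continuous_on {a..b} (\<lambda>x. c * f x + d * g x)"
      by (intro continuous_intros assms)
    show "uniform_limit (real_spectrum A) (\<lambda>n x. poly (smult c (p n) + smult d (q n)) x)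
        (\<lambda>x. c * f x + d * g x) sequentially"
      unfolding poly_add poly_smult
      by (intro uniform_limit_add bounded_linear.uniform_limit[OF bounded_linear_mult_right] p q)
    show "(\<lambda>n. poly_op (smult c (p n) + smult d (q n)) A) \<longlonglongrightarrow> c *\<^sub>R fun_calc f A + d *\<^sub>R fun_calc g A"
      unfolding poly_op_add poly_op_smult by (intro tendsto_intros p q)
  qed
qed

text \<open>The approximating polynomials may dip slightly below zero on the spectrum. Adding a
  small constant d makes them nonnegative there and costs d times the squared norm of x, which is at
  most e.\<close>

lemma fun_calc_nonneg:
  fixes A :: "'a::complex_hilbert \<Rightarrow>\<^sub>L 'a"
  assumes "self_adjoint A" and sub: "real_spectrum A \<subseteq> {a..b}" and "continuous_on {a..b} f"
    and nonneg: "\<And>x. a \<le> x \<Longrightarrow> x \<le> b \<Longrightarrow> 0 \<le> f x"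
  shows "0 \<le> fun_calc f A x \<bullet> x"
proof (rule field_le_epsilon)
  fix e :: real assume "e > 0"
  obtain p where p: "uniform_limit (real_spectrum A) (\<lambda>n x. poly (p n) x) f sequentially"
    "(\<lambda>n. poly_op (p n) A) \<longlonglongrightarrow> fun_calc f A"
    by (rule fun_calc_obtain_poly[OF assms(1-3)])
  define d where "d = e / ((norm x)\<^sup>2 + 1)"
  have "(norm x)\<^sup>2 + 1 > 0" by (simp add: add_nonneg_pos)
  then have d: "d > 0" "d * (norm x)\<^sup>2 \<le> e"
    using \<open>e > 0\<close> by (auto simp: d_def field_simps)
  have "(\<lambda>n. poly_op (p n) A x \<bullet> x) \<longlonglongrightarrow> fun_calc f A x \<bullet> x"
    by (intro tendsto_intros p)
  moreover have "\<forall>\<^sub>F n in sequentially. - e \<le> poly_op (p n) A x \<bullet> x"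
    using uniform_limitD[OF p(1) d(1)]
  proof eventually_elim
    case (elim n)
    have "0 \<le> poly_op (p n + [:d:]) A x \<bullet> x"
    proof (rule poly_op_nonneg[OF assms(1)])
      fix y assume y: "y \<in> real_spectrum A"
      then have "0 \<le> f y" using nonneg sub by auto
      then show "0 \<le> poly (p n + [:d:]) y"
        using elim y by (force simp: dist_real_def)
    qed
    also have "\<dots> = poly_op (p n) A x \<bullet> x + d * (norm x)\<^sup>2"
      by (simp add: poly_op_add blinfun.bilinear_simps inner_simps power2_norm_eq_inner)
    finally show ?case using d(2) by simp
  qed
  ultimately have "- e \<le> fun_calc f A x \<bullet> x"
    by (rule tendsto_lowerbound) simp
  then show "0 \<le> fun_calc f A x \<bullet> x + e" by simp
qed

text \<open>If p_n approximates x^(-1/2), then p_n x p_n approximates the constant 1 on the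
  spectrum, while its operator value tends to the sandwich.\<close>

lemma op_powr_minus_half_sandwich:
  fixes A :: "'a::complex_hilbert \<Rightarrow>\<^sub>L 'a"
  assumes "self_adjoint A" and sub: "real_spectrum A \<subseteq> {a..b}" and "0 < a"
  shows "op_powr A (-1/2) o\<^sub>L A o\<^sub>L op_powr A (-1/2) = id_blinfun"
proof -
  let ?f = "\<lambda>x :: real. x powr (-1/2)"
  have cont: "continuous_on {a..b} ?f"
    using \<open>0 < a\<close> by (intro continuous_intros) auto
  obtain p where p: "uniform_limit (real_spectrum A) (\<lambda>n x. poly (p n) x) ?f sequentially"
    "(\<lambda>n. poly_op (p n) A) \<longlonglongrightarrow> fun_calc ?f A"
    by (rule fun_calc_obtain_poly[OF assms(1,2) cont])
  \<comment> \<open>Uniform limits may be multiplied only when the limit functions are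
    bounded.\<close>
  have bounded: "bounded (g ` real_spectrum A)" if "continuous_on {a..b} g" for g :: "real \<Rightarrow> real"
    using compact_imp_bounded[OF compact_continuous_image[OF that compact_Icc]] sub
    by (meson bounded_subset image_mono)
  have lim: "uniform_limit (real_spectrum A) (\<lambda>n x. poly (p n * [:0, 1:] * p n) x)
      (\<lambda>x. ?f x * x * ?f x) sequentially"
  proof -
    have "uniform_limit (real_spectrum A) (\<lambda>n x. poly [:0, 1:] x) (\<lambda>x. x) sequentially"
      by (simp add: uniform_limit_const)
    moreover have "bounded (?f ` real_spectrum A)" "bounded ((\<lambda>x. x) ` real_spectrum A)"
      "bounded ((\<lambda>x. ?f x * x) ` real_spectrum A)"
      by (intro bounded continuous_on_mult cont continuous_on_id)+
    ultimately show ?thesis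
      unfolding poly_mult by (intro uniform_lim_mult p(1))
  qed
  have one: "?f x * x * ?f x = 1" if "x \<in> {a..b}" for x
  proof -
    have "?f x * x * ?f x = ?f x * x powr 1 * ?f x"
      using that \<open>0 < a\<close> by simp
    also have "\<dots> = x powr (-1/2 + 1 + -1/2)"
      by (simp only: powr_add)
    finally show ?thesis using that \<open>0 < a\<close> by simp
  qed
  have "poly_op (p n * [:0, 1:] * p n) A = poly_op (p n) A o\<^sub>L A o\<^sub>L poly_op (p n) A" for n
    by (simp only: poly_op_mult) (simp add: blinfun_eq_iff blinfun.bilinear_simps)
  then have "(\<lambda>n. poly_op (p n * [:0, 1:] * p n) A) \<longlonglongrightarrow> (fun_calc ?f A o\<^sub>L A o\<^sub>L fun_calc ?f A)"
    by (simp only:)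
      (intro bounded_bilinear.tendsto[OF bounded_bilinear_blinfun_compose] tendsto_const p)
  with lim have "fun_calc (\<lambda>x. ?f x * x * ?f x) A = fun_calc ?f A o\<^sub>L A o\<^sub>L fun_calc ?f A"
    by (rule fun_calc_eqI[OF assms(1,2)
          continuous_on_mult[OF continuous_on_mult[OF cont continuous_on_id] cont]])
  moreover have "fun_calc (\<lambda>x. ?f x * x * ?f x) A = id_blinfun"
  \<comment> \<open>Only values on the spectrum matter, and there the product equals 1, so the
    constant polynomial approximates it.\<close>
  proof (rule fun_calc_eqI[OF assms(1,2), where p = "\<lambda>n. [:1:]"])
    show "continuous_on {a..b} (\<lambda>x. ?f x * x * ?f x)"
      by (intro continuous_on_mult cont continuous_on_id)
    show "uniform_limit (real_spectrum A) (\<lambda>n. poly [:1:]) (\<lambda>x. ?f x * x * ?f x) sequentially"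
      using one sub by (intro uniform_limitI) auto
  qed simp
  ultimately show ?thesis
    by (simp add: op_powr_def)
qed

section \<open>Monotonicity of eta and the scalar bounds\<close>

section \<open>The scalar inequality\<close>

text \<open>The inequality u <= 2 sinh(u/2), multiplied by exp(u/2) and squared. It gives the sign
  of the derivative of \<open>eta_kernel\<close>.\<close>

lemma square_mult_exp_le: "(u::real)\<^sup>2 * exp u \<le> (exp u - 1)\<^sup>2" if "0 \<le> u"
proof -
  have "u / 2 \<le> (exp (u / 2) - exp (- (u / 2))) / 2"
    using real_le_x_sinh[of "u / 2"] that by (simp add: exp_minus)
  then have "u * exp (u / 2) \<le> (exp (u / 2) - exp (- (u / 2))) * exp (u / 2)"
    by (intro mult_right_mono) auto
  also have "\<dots> = exp u - 1"
    by (simp add: left_diff_distrib flip: exp_add)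
  finally have "(u * exp (u / 2))\<^sup>2 \<le> (exp u - 1)\<^sup>2"
    using that by (intro power_mono) auto
  then show ?thesis
    by (simp add: power_mult_distrib flip: exp_double)
qed

text \<open>The logarithmic derivative of (exp u - 1)/u.\<close>

definition eta_kernel :: "real \<Rightarrow> real"
  where "eta_kernel u = 1 + 1 / (exp u - 1) - 1 / u"

lemma eta_kernel_mono:
  assumes "0 < u" "u \<le> v"
  shows "eta_kernel u \<le> eta_kernel v"
proof (rule DERIV_nonneg_imp_nondecreasing[OF assms(2)])
  fix x assume "u \<le> x" "x \<le> v"
  then have "0 < x" using assms by simp
  then have "(eta_kernel has_real_derivative (1 / x\<^sup>2 - exp x / (exp x - 1)\<^sup>2)) (at x)"
    unfolding eta_kernel_def[abs_def]
    by (auto intro!: derivative_eq_intros simp: power2_eq_square)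
  moreover have "exp x / (exp x - 1)\<^sup>2 \<le> 1 / x\<^sup>2"
    using square_mult_exp_le[of x] \<open>0 < x\<close> by (simp add: divide_simps mult.commute)
  ultimately show "\<exists>y. (eta_kernel has_real_derivative y) (at x) \<and> 0 \<le> y"
    by (metis diff_ge_0_iff_ge)
qed

text \<open>After clearing denominators this is (1 - u) exp u <= 1, that is, 1 - u <=
  exp(-u).\<close>

lemma eta_kernel_nonneg:
  assumes "0 < u"
  shows "0 \<le> eta_kernel u"
proof -
  have "(1 - u) * exp u \<le> exp (- u) * exp u"
    using exp_ge_add_one_self[of "- u"] by (intro mult_right_mono) auto
  then have "(1 - u) * exp u \<le> 1"
    by (simp flip: exp_add)
  then show ?thesis
    using assms by (simp add: eta_kernel_def field_simps)
qed

lemma tsallis_ln_pos: "1 < x \<Longrightarrow> 0 < a \<Longrightarrow> 0 < tsallis_ln a x"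
  by (simp add: tsallis_ln_def)

lemma eta_eq_kernel:
  assumes "1 < x" "0 < a"
  shows "eta x a = ln x * eta_kernel (a * ln x)"
proof -
  have "exp (a * ln x) = x powr a" "x powr a > 1" "ln x > 0"
    using assms by (auto simp: powr_def)
  then show ?thesis
    using assms by (simp add: eta_def eta_kernel_def tsallis_ln_def field_simps)
qed

lemma eta_mono:
  assumes "1 \<le> x" "x \<le> y" "0 < a" "a \<le> b"
  shows "eta x a \<le> eta y b"
proof (cases "x = 1")
  \<comment> \<open>Here \<open>eta x a\<close> has its separately defined value 0, so only
    nonnegativity of \<open>eta y b\<close> is left.\<close>
  case True
  then show ?thesis
    using assms eta_eq_kernel[of y b] eta_kernel_nonneg[of "b * ln y"]
    by (cases "y = 1") (auto simp: eta_def)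
next
  case False
  then have "0 < ln x" "ln x \<le> ln y" using assms by auto
  then have "ln x * eta_kernel (a * ln x) \<le> ln y * eta_kernel (b * ln y)"
    using assms by (intro mult_mono eta_kernel_mono eta_kernel_nonneg) (auto intro: mult_mono)
  then show ?thesis
    using False assms by (simp add: eta_eq_kernel)
qed

text \<open>\<open>eta x a\<close> is the derivative of \<open>ln (tsallis_ln a x)\<close> with respect to \<open>a\<close>.\<close>

lemma tsallis_ln_bounds:
  assumes "1 \<le> x" "0 < s" "s \<le> t"
  shows "exp (eta x s * (t - s)) * tsallis_ln s x \<le> tsallis_ln t x"
    and "tsallis_ln t x \<le> exp (eta x t * (t - s)) * tsallis_ln s x"
proof -
  have "exp (eta x s * (t - s)) * tsallis_ln s x \<le> tsallis_ln t x \<and>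
    tsallis_ln t x \<le> exp (eta x t * (t - s)) * tsallis_ln s x"
  proof (cases "x = 1 \<or> s = t")
    \<comment> \<open>For x = 1 both deformed logarithms vanish, and for s = t the exponents
      do.\<close>
    case True
    then show ?thesis by (auto simp: tsallis_ln_def)
  next
    case False
    then have x: "1 < x" and "s < t" using assms by auto
    have "((\<lambda>a. ln (tsallis_ln a x)) has_real_derivative eta x a) (at a)" if "s \<le> a" for a
    proof -
      have "a > 0" "x powr a > 1" "tsallis_ln a x > 0"
        using that assms x tsallis_ln_pos by auto
      then show ?thesis
        using x unfolding eta_def tsallis_ln_def
        by (auto intro!: derivative_eq_intros simp: field_simps)
    qed
    then obtain c where c: "s < c" "c < t"
      "ln (tsallis_ln t x) - ln (tsallis_ln s x) = (t - s) * eta x c"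
      using MVT2[OF \<open>s < t\<close>, of "\<lambda>a. ln (tsallis_ln a x)" "eta x"] by auto
    have pos: "tsallis_ln t x > 0" "tsallis_ln s x > 0"
      using x assms tsallis_ln_pos by auto
    \<comment> \<open>Exponentiating the mean value identity gives an exact formula with exponent
      \<open>eta x c\<close>; monotonicity in the second argument then replaces c by s or t.\<close>
    have "tsallis_ln t x = exp (ln (tsallis_ln t x) - ln (tsallis_ln s x)) * tsallis_ln s x"
      using pos by (simp add: exp_diff)
    then have eq: "tsallis_ln t x = exp (eta x c * (t - s)) * tsallis_ln s x"
      by (simp add: c(3) mult.commute)
    have "eta x s * (t - s) \<le> eta x c * (t - s)" "eta x c * (t - s) \<le> eta x t * (t - s)"
      using c assms by (auto intro!: mult_right_mono eta_mono)
    then show ?thesis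
      unfolding eq using pos by (auto intro!: mult_right_mono)
  qed
  then show "exp (eta x s * (t - s)) * tsallis_ln s x \<le> tsallis_ln t x"
    and "tsallis_ln t x \<le> exp (eta x t * (t - s)) * tsallis_ln s x" by auto
qed

lemma tsallis_ln_nonneg: "1 \<le> x \<Longrightarrow> 0 < a \<Longrightarrow> 0 \<le> tsallis_ln a x"
  by (simp add: tsallis_ln_def ge_one_powr_ge_zero)

text \<open>\<open>eta\<close> increases in x, so the exponents can be moved to the ends of the
  interval; \<open>tsallis_ln s x\<close> is nonnegative there, so multiplying by it keeps the
  order.\<close>

lemma tsallis_ln_bounds_interval:
  assumes "1 \<le> m" "m \<le> x" "x \<le> M" "0 < s" "s \<le> t"
  shows "exp (eta m s * (t - s)) * tsallis_ln s x \<le> tsallis_ln t x"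
    and "tsallis_ln t x \<le> exp (eta M t * (t - s)) * tsallis_ln s x"
proof -
  have "exp (eta m s * (t - s)) * tsallis_ln s x \<le> exp (eta x s * (t - s)) * tsallis_ln s x"
    "exp (eta x t * (t - s)) * tsallis_ln s x \<le> exp (eta M t * (t - s)) * tsallis_ln s x"
    using assms by (auto intro!: mult_right_mono eta_mono tsallis_ln_nonneg)
  with tsallis_ln_bounds[of x s t] assms
  show "exp (eta m s * (t - s)) * tsallis_ln s x \<le> tsallis_ln t x"
    and "tsallis_ln t x \<le> exp (eta M t * (t - s)) * tsallis_ln s x" by auto
qed

text \<open>Moves the exponential to the other side, which turns bounds for the pair (t, s) into
  bounds for (s, t).\<close>

lemma exp_neg_mult_le_iff:
  fixes k u v d :: real
  shows "exp (k * - d) * u \<le> v \<longleftrightarrow> u \<le> exp (k * d) * v"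
    and "v \<le> exp (k * - d) * u \<longleftrightarrow> exp (k * d) * v \<le> u"
  by (simp_all add: exp_minus field_simps)

section \<open>Transfer of scalar inequalities to the entropies\<close>

section \<open>Tsallis relative operator entropy\<close>

text \<open>The quadratic form of H X H at x is that of X at H x, so a comparison of forms survives
  the congruence.\<close>

lemma op_le_scaleR_sandwich:
  fixes H X Y :: "'a::complex_hilbert \<Rightarrow>\<^sub>L 'a"
  assumes "self_adjoint H" "self_adjoint X" "self_adjoint Y"
    and le: "\<And>x. c * (X x \<bullet> x) \<le> Y x \<bullet> x"
  shows "c *\<^sub>R (H o\<^sub>L X o\<^sub>L H) \<sqsubseteq> H o\<^sub>L Y o\<^sub>L H"
proof -
  have sa: "self_adjoint (c *\<^sub>R (H o\<^sub>L X o\<^sub>L H))" "self_adjoint (H o\<^sub>L Y o\<^sub>L H)"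
    by (intro self_adjoint_scaleR self_adjoint_sandwich assms)+
  have "0 \<le> ((H o\<^sub>L Y o\<^sub>L H) - c *\<^sub>R (H o\<^sub>L X o\<^sub>L H)) x \<bullet> x" for x
    using le[of "H x"] self_adjoint_inner[OF assms(1), of _ x]
    by (simp add: blinfun.bilinear_simps inner_diff_left)
  then show ?thesis
    using sa self_adjoint_diff[OF sa(2,1)] by (simp add: op_le_def positive_op_def inner_Re_cinner)
qed

lemma op_le_inner:
  "X \<sqsubseteq> Y \<Longrightarrow> blinfun_apply X x \<bullet> x \<le> blinfun_apply Y x \<bullet> x"
  by (simp add: op_le_def positive_op_def inner_Re_cinner[symmetric] blinfun.bilinear_simps inner_simps)

text \<open>Coefficients on both sides let one statement serve for positivity (c = 0), lower bounds
  (d = 1) and upper bounds (c = 1).\<close>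

lemma tsallis_entropy_le:
  fixes A B :: "'a::complex_hilbert \<Rightarrow>\<^sub>L 'a"
  assumes A: "positive_op A" "invertible_op A" and B: "positive_op B"
    and mM: "m *\<^sub>R A \<sqsubseteq> B" "B \<sqsubseteq> M *\<^sub>R A" and "0 < m"
    and le: "\<And>x. m \<le> x \<Longrightarrow> x \<le> M \<Longrightarrow> c * tsallis_ln s x \<le> d * tsallis_ln t x"
  shows "c *\<^sub>R tsallis_entropy s A B \<sqsubseteq> d *\<^sub>R tsallis_entropy t A B"
proof -
  \<comment> \<open>The strictly positive lower end keeps the spectrum of A away from 0, so all real
    powers are continuous on an interval containing it.\<close>
  obtain a where a: "a > 0" "\<And>x. a * (norm x)\<^sup>2 \<le> A x \<bullet> x"
    using positive_invertible_imp_coercive[OF A] by blast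
  have saA: "self_adjoint A" and saB: "self_adjoint B"
    using A B by (auto simp: positive_op_def)
  have specA: "real_spectrum A \<subseteq> {a..norm A}"
    using a quadratic_form_le_norm[of A] by (intro real_spectrum_subset) (auto intro: abs_le_D1)
  define H K where "H = op_powr A (1/2)" and "K = op_powr A (-1/2)"
  have "continuous_on {a..norm A} (\<lambda>x. x powr r)" for r :: real
    using a by (intro continuous_intros) auto
  then have sa: "self_adjoint H" "self_adjoint K"
    unfolding H_def K_def op_powr_def by (auto intro!: self_adjoint_fun_calc[OF saA specA])
  have KAK: "K o\<^sub>L A o\<^sub>L K = id_blinfun"
    unfolding K_def by (rule op_powr_minus_half_sandwich[OF saA specA a(1)])
  define C where "C = K o\<^sub>L B o\<^sub>L K"
  have saC: "self_adjoint C"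
    unfolding C_def by (intro self_adjoint_sandwich sa saB)
  \<comment> \<open>Evaluating the hypotheses on B at K x thus bounds the form of \<open>C\<close>
    between m and M times the squared norm of x.\<close>
  have KA: "A (K x) \<bullet> K x = (norm x)\<^sup>2" for x
  proof -
    have "A (K x) \<bullet> K x = (K o\<^sub>L A o\<^sub>L K) x \<bullet> x"
      using self_adjoint_inner[OF sa(2)] by simp
    then show ?thesis by (simp add: KAK power2_norm_eq_inner)
  qed
  have CB: "C x \<bullet> x = B (K x) \<bullet> K x" for x
    using self_adjoint_inner[OF sa(2)] by (simp add: C_def)
  have specC: "real_spectrum C \<subseteq> {m..M}"
    using op_le_inner[OF mM(1)] op_le_inner[OF mM(2)]
    by (intro real_spectrum_subset) (auto simp: CB blinfun.bilinear_simps simp flip: KA)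
  have cont: "continuous_on {m..M} (tsallis_ln r)" for r
    unfolding tsallis_ln_def[abs_def] divide_inverse using \<open>0 < m\<close> by (intro continuous_intros) auto
  have "c * (fun_calc (tsallis_ln s) C x \<bullet> x) \<le> (d *\<^sub>R fun_calc (tsallis_ln t) C) x \<bullet> x" for x
  proof -
    \<comment> \<open>The two sides differ by the calculus of a single function that is nonnegative
      on the interval.\<close>
    have "0 \<le> fun_calc (\<lambda>x. d * tsallis_ln t x + (- c) * tsallis_ln s x) C x \<bullet> x"
      using le by (intro fun_calc_nonneg[OF saC specC]) (auto intro!: continuous_intros cont)
    then show ?thesis
      unfolding fun_calc_linear[OF saC specC cont cont]
      by (simp add: blinfun.bilinear_simps inner_simps)
  qed
  then have "c *\<^sub>R (H o\<^sub>L fun_calc (tsallis_ln s) C o\<^sub>L H) \<sqsubseteq> H o\<^sub>L d *\<^sub>R fun_calc (tsallis_ln t) C o\<^sub>L H"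
    by (intro op_le_scaleR_sandwich sa self_adjoint_scaleR self_adjoint_fun_calc[OF saC specC] cont)
  moreover have "H o\<^sub>L d *\<^sub>R fun_calc (tsallis_ln t) C o\<^sub>L H = d *\<^sub>R (H o\<^sub>L fun_calc (tsallis_ln t) C o\<^sub>L H)"
    by (simp add: blinfun_eq_iff blinfun.bilinear_simps)
  ultimately show ?thesis
    by (simp add: tsallis_entropy_def H_def K_def C_def)
qed

theorem theorem3p5:
  fixes A B :: "'a::complex_hilbert \<Rightarrow>\<^sub>L 'a" and m M s t :: real
  assumes "positive_op A" and "invertible_op A"
    and "positive_op B" and "invertible_op B"
    and "m *\<^sub>R A \<sqsubseteq> B" and "B \<sqsubseteq> M *\<^sub>R A"
    and "1 \<le> m" and "m \<le> M"
    and "s > 0" and "t > 0"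
  shows
    "(t \<ge> s \<longrightarrow>
       0 \<sqsubseteq> exp (eta m s * (t - s)) *\<^sub>R tsallis_entropy s A B \<and>
       exp (eta m s * (t - s)) *\<^sub>R tsallis_entropy s A B \<sqsubseteq> tsallis_entropy t A B \<and>
       tsallis_entropy t A B \<sqsubseteq> exp (eta M t * (t - s)) *\<^sub>R tsallis_entropy s A B) \<and>
     (s \<ge> t \<longrightarrow>
       0 \<sqsubseteq> exp (eta M s * (t - s)) *\<^sub>R tsallis_entropy s A B \<and>
       exp (eta M s * (t - s)) *\<^sub>R tsallis_entropy s A B \<sqsubseteq> tsallis_entropy t A B \<and>
       tsallis_entropy t A B \<sqsubseteq> exp (eta m t * (t - s)) *\<^sub>R tsallis_entropy s A B)"
proof -
  note le = tsallis_entropy_le[OF assms(1-3,5,6)]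
  have "0 < m" using assms by simp
  have nonneg: "0 \<sqsubseteq> exp r *\<^sub>R tsallis_entropy s A B" for r
    using le[of 0 s "exp r" s] \<open>1 \<le> m\<close> \<open>0 < s\<close>
    by (simp add: mult_nonneg_nonneg tsallis_ln_nonneg)
  have lower: "exp r *\<^sub>R tsallis_entropy s A B \<sqsubseteq> tsallis_entropy t A B"
    if "\<And>x. m \<le> x \<Longrightarrow> x \<le> M \<Longrightarrow> exp r * tsallis_ln s x \<le> tsallis_ln t x" for r
    using le[of "exp r" s 1 t] that \<open>0 < m\<close> by simp
  have upper: "tsallis_entropy t A B \<sqsubseteq> exp r *\<^sub>R tsallis_entropy s A B"
    if "\<And>x. m \<le> x \<Longrightarrow> x \<le> M \<Longrightarrow> tsallis_ln t x \<le> exp r * tsallis_ln s x" for r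
    using le[of 1 t "exp r" s] that \<open>0 < m\<close> by simp
  have ts: "t - s = - (s - t)" by simp
  show ?thesis
  proof (intro conjI impI nonneg lower upper)
    fix x assume x: "m \<le> x" "x \<le> M"
    note bounds = tsallis_ln_bounds_interval[OF \<open>1 \<le> m\<close> x]
    show "exp (eta m s * (t - s)) * tsallis_ln s x \<le> tsallis_ln t x" if "s \<le> t"
      using bounds(1) that assms by simp
    show "tsallis_ln t x \<le> exp (eta M t * (t - s)) * tsallis_ln s x" if "s \<le> t"
      using bounds(2) that assms by simp
    \<comment> \<open>The remaining two bounds come from the interval bounds with s and t exchanged:
      the upper one becomes a lower one and conversely.\<close>
    show "exp (eta M s * (t - s)) * tsallis_ln s x \<le> tsallis_ln t x" if "t \<le> s"
      using bounds(2)[of t s] that assms unfolding ts exp_neg_mult_le_iff by simp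
    show "tsallis_ln t x \<le> exp (eta m t * (t - s)) * tsallis_ln s x" if "t \<le> s"
      using bounds(1)[of t s] that assms unfolding ts exp_neg_mult_le_iff by simp
  qed
qed

end
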